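(* For every positive integer $\ell$, there exists a vertex-transitive graph $G$ with $|V(G)|\le 4\ell+12$ and $r_+(G)\ge\ell$.
   Context: For $P\subseteq[0,1]^n$: $P_I=\mathrm{conv}(P\cap\{0,1\}^n)$, $\mathrm{cone}(P)=\{(\lambda,\lambda x):\lambda\ge0,x\in P\}\subseteq\mathbb{R}^{n+1}$ (coordinates $0,\dots,n$), $\widehat{\mathrm{LS}}_+(P)=\{Y\in\mathbb{S}^{n+1}_+:Ye_0=\mathrm{diag}(Y),\ Ye_i,\ Y(e_0-e_i)\in\mathrm{cone}(P)\ \forall i\in[n]\}$, $\mathrm{LS}_+(P)=\{x:\exists Y\in\widehat{\mathrm{LS}}_+(P),\ Ye_0=(1,x)\}$, $\mathrm{LS}_+^0(P)=P$, $\mathrm{LS}_+^k(P)=\mathrm{LS}_+(\mathrm{LS}_+^{k-1}(P))$. For a graph $G$, $\mathrm{FRAC}(G)=\{x\in[0,1]^{V(G)}:x_i+x_j\le1\ \forall\{i,j\}\in E(G)\}$, $\mathrm{STAB}(G)=\mathrm{FRAC}(G)_I$, and $r_+(G)$ is the least $k$ with $\mathrm{LS}_+^k(\mathrm{FRAC}(G))=\mathrm{STAB}(G)$. *)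

theory Defs
  imports Complex_Main "HOL-Library.Extended_Nat"
begin

text \<open>
  For a finite set \<open>V\<close>, the space \<open>\<real>\<^sup>V\<close> is represented by the functions that vanish outside
  \<open>V\<close>, so that equality of vectors is equality of functions.  The extra coordinate \<open>0\<close> of
  \<open>\<real>\<^sup>n\<^sup>+\<^sup>1\<close> is \<open>None\<close>, and the coordinate belonging to \<open>i \<in> V\<close> is \<open>Some i\<close>.
\<close>

definition vecs :: "'a set \<Rightarrow> ('a \<Rightarrow> real) set" where
  "vecs V = {x. \<forall>i. i \<notin> V \<longrightarrow> x i = 0}"

definition mats :: "'a set \<Rightarrow> ('a \<Rightarrow> 'a \<Rightarrow> real) set" where
  "mats I = {Y. \<forall>i j. i \<notin> I \<or> j \<notin> I \<longrightarrow> Y i j = 0}"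

definition sym_psd :: "'a set \<Rightarrow> ('a \<Rightarrow> 'a \<Rightarrow> real) set" where
  "sym_psd I = {Y \<in> mats I. (\<forall>i\<in>I. \<forall>j\<in>I. Y i j = Y j i) \<and>
     (\<forall>v. 0 \<le> (\<Sum>i\<in>I. \<Sum>j\<in>I. v i * Y i j * v j))}"

definition conv_hull :: "('a \<Rightarrow> real) set \<Rightarrow> ('a \<Rightarrow> real) set" where
  "conv_hull A = {(\<lambda>i. \<Sum>s\<in>S. u s * s i) | S u.
     finite S \<and> S \<subseteq> A \<and> (\<forall>s\<in>S. 0 \<le> u s) \<and> sum u S = 1}"

definition integer_hull :: "'a set \<Rightarrow> ('a \<Rightarrow> real) set \<Rightarrow> ('a \<Rightarrow> real) set" where
  "integer_hull V P = conv_hull (P \<inter> {x \<in> vecs V. \<forall>i\<in>V. x i \<in> {0, 1}})"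

definition homog_index :: "'a set \<Rightarrow> 'a option set" where
  "homog_index V = insert None (Some ` V)"

definition homog_vec :: "real \<Rightarrow> ('a \<Rightarrow> real) \<Rightarrow> 'a option \<Rightarrow> real" where
  "homog_vec t x = case_option t x"

definition homog_cone :: "('a \<Rightarrow> real) set \<Rightarrow> ('a option \<Rightarrow> real) set" where
  "homog_cone P = {homog_vec t (\<lambda>i. t * x i) | t x. 0 \<le> t \<and> x \<in> P}"

text \<open>\<open>Y e\<^sub>i\<close> is the column \<open>\<lambda>j. Y j i\<close>.\<close>

definition LS_plus_lift :: "'a set \<Rightarrow> ('a \<Rightarrow> real) set \<Rightarrow> ('a option \<Rightarrow> 'a option \<Rightarrow> real) set" where
  "LS_plus_lift V P = {Y \<in> sym_psd (homog_index V).
     (\<lambda>j. Y j None) = (\<lambda>j. Y j j) \<and>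
     (\<forall>i\<in>V. (\<lambda>j. Y j (Some i)) \<in> homog_cone P \<and>
            (\<lambda>j. Y j None - Y j (Some i)) \<in> homog_cone P)}"

definition LS_plus :: "'a set \<Rightarrow> ('a \<Rightarrow> real) set \<Rightarrow> ('a \<Rightarrow> real) set" where
  "LS_plus V P = {x \<in> vecs V. \<exists>Y\<in>LS_plus_lift V P. (\<lambda>j. Y j None) = homog_vec 1 x}"

definition simple_graph :: "'a set \<Rightarrow> 'a set set \<Rightarrow> bool" where
  "simple_graph V E \<longleftrightarrow> finite V \<and> E \<subseteq> {{u, v} | u v. u \<in> V \<and> v \<in> V \<and> u \<noteq> v}"

definition graph_automorphism :: "'a set \<Rightarrow> 'a set set \<Rightarrow> ('a \<Rightarrow> 'a) \<Rightarrow> bool" where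
  "graph_automorphism V E f \<longleftrightarrow> bij_betw f V V \<and>
     (\<forall>u\<in>V. \<forall>v\<in>V. {f u, f v} \<in> E \<longleftrightarrow> {u, v} \<in> E)"

definition vertex_transitive :: "'a set \<Rightarrow> 'a set set \<Rightarrow> bool" where
  "vertex_transitive V E \<longleftrightarrow> (\<forall>u\<in>V. \<forall>v\<in>V. \<exists>f. graph_automorphism V E f \<and> f u = v)"

definition FRAC :: "'a set \<Rightarrow> 'a set set \<Rightarrow> ('a \<Rightarrow> real) set" where
  "FRAC V E = {x \<in> vecs V. (\<forall>i\<in>V. 0 \<le> x i \<and> x i \<le> 1) \<and>
     (\<forall>i\<in>V. \<forall>j\<in>V. {i, j} \<in> E \<longrightarrow> x i + x j \<le> 1)}"

definition STAB :: "'a set \<Rightarrow> 'a set set \<Rightarrow> ('a \<Rightarrow> real) set" where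
  "STAB V E = integer_hull V (FRAC V E)"

text \<open>
  The infimum in \<open>enat\<close> is the least element of a nonempty set of naturals (and \<open>\<infinity>\<close>, not an
  unspecified number, for the empty set).
\<close>

definition r_plus :: "'a set \<Rightarrow> 'a set set \<Rightarrow> enat" where
  "r_plus V E = Inf (enat ` {k. (LS_plus V ^^ k) (FRAC V E) = STAB V E})"

end

theory Submission
  imports Defs
begin

text \<open>
  Let \<open>n = 2h + 1\<close> and let \<open>i \<rightarrow> j\<close> be the circular tournament on \<open>n\<close> indices.  The graph has
  vertices \<open>i\<^sub>0, i\<^sub>1, i\<^sub>2, i\<^sub>3\<close> for each index, coded as \<open>4i + p\<close>; these four form a cycle, and
  \<open>i\<^sub>2 \<sim> j\<^sub>0\<close>, \<open>i\<^sub>3 \<sim> j\<^sub>1\<close> whenever \<open>i \<rightarrow> j\<close>.  A stable set contains both \<open>i\<^sub>0\<close> and \<open>i\<^sub>2\<close> for at most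
  one \<open>i\<close>, so it has at most \<open>n + 1\<close> vertices in layers 0, 1, 2.

  For a set \<open>I\<close> of \<open>k + 3\<close> indices, add the incidence vectors of the tight sets with all activity
  in \<open>I\<close> and subtract a small multiple \<open>\<epsilon>\<close> of that of the set \<open>M\<close> of all \<open>i\<^sub>1\<close>, which has only \<open>n\<close>
  vertices.  By induction on \<open>k\<close> the result lies in the cone over the \<open>k\<close>-th relaxation, although
  it violates the inequality.  The lift is the sum of the rank-one matrices of the tight sets, minus
  \<open>\<epsilon>\<close> times that of \<open>M\<close>, plus \<open>\<epsilon>\<close> in the two entries indexed by \<open>a\<^sub>1, b\<^sub>1\<close>, where
  \<open>c \<rightarrow> a, b \<rightarrow> d\<close> in \<open>I\<close>.  The last term restores positive semidefiniteness because the unit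
  vectors of \<open>a\<^sub>1\<close> and \<open>b\<^sub>1\<close> are combinations of tight sets minus \<open>M\<close>.  Columns of \<open>i\<^sub>0, i\<^sub>2\<close> are sums
  of stable sets; those of \<open>i\<^sub>1\<close>, and the complementary columns of \<open>i\<^sub>0, i\<^sub>2\<close>, come from \<open>I - {i}\<close>.
\<close>

section \<open>The Lovasz-Schrijver operator on convex sets\<close>

definition convex_vecs :: "('a \<Rightarrow> real) set \<Rightarrow> bool" where
  "convex_vecs P \<longleftrightarrow>
     (\<forall>x\<in>P. \<forall>y\<in>P. \<forall>u. 0 \<le> u \<longrightarrow> u \<le> 1 \<longrightarrow> (\<lambda>i. u * x i + (1 - u) * y i) \<in> P)"

lemma homog_cone_iff:
  "y \<in> homog_cone P \<longleftrightarrow>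
     (\<exists>x\<in>P. 0 \<le> y None \<and> (\<forall>i. y (Some i) = y None * x i))"
proof
  assume "y \<in> homog_cone P"
  then show "\<exists>x\<in>P. 0 \<le> y None \<and> (\<forall>i. y (Some i) = y None * x i)"
    by (auto simp: homog_cone_def homog_vec_def)
next
  assume "\<exists>x\<in>P. 0 \<le> y None \<and> (\<forall>i. y (Some i) = y None * x i)"
  then obtain x where "x \<in> P" "0 \<le> y None" "\<And>i. y (Some i) = y None * x i" by auto
  then have "y = homog_vec (y None) (\<lambda>i. y None * x i)"
    by (auto simp: homog_vec_def fun_eq_iff split: option.split)
  then show "y \<in> homog_cone P"
    using \<open>x \<in> P\<close> \<open>0 \<le> y None\<close> unfolding homog_cone_def by blast
qed

lemma homog_cone_scale:
  assumes "a \<in> homog_cone P" "0 \<le> t"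
  shows "(\<lambda>j. t * a j) \<in> homog_cone P"
  using assms unfolding homog_cone_iff by (auto simp: mult.assoc)

text \<open>Convexity enters here: after division by \<open>a None + b None\<close> the sum is a
  convex combination of \<open>x\<close> and \<open>y\<close>. If both scalars vanish, the sum is
  the zero vector.\<close>

lemma homog_cone_add:
  assumes P: "convex_vecs P" and a: "a \<in> homog_cone P" and b: "b \<in> homog_cone P"
  shows "(\<lambda>j. a j + b j) \<in> homog_cone P"
proof -
  obtain x where x: "x \<in> P" "0 \<le> a None" "\<And>i. a (Some i) = a None * x i"
    using a unfolding homog_cone_iff by auto
  obtain y where y: "y \<in> P" "0 \<le> b None" "\<And>i. b (Some i) = b None * y i"
    using b unfolding homog_cone_iff by auto
  show ?thesis
  proof (cases "a None + b None = 0")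
    case True
    with x y have "a None = 0" "b None = 0" by auto
    with x y show ?thesis unfolding homog_cone_iff by auto
  next
    case False
    define u where "u = a None / (a None + b None)"
    have s: "a None + b None > 0" using False x(2) y(2) by linarith
    have u: "0 \<le> u" "u \<le> 1" using x(2) y(2) s by (auto simp: u_def)
    have ua: "(a None + b None) * u = a None" using s by (simp add: u_def)
    then have ub: "(a None + b None) * (1 - u) = b None" by (simp add: algebra_simps)
    have "(\<lambda>i. u * x i + (1 - u) * y i) \<in> P"
      using P x(1) y(1) u unfolding convex_vecs_def by blast
    moreover have "a (Some i) + b (Some i) = (a None + b None) * (u * x i + (1 - u) * y i)" for i
      using ua ub x(3) y(3) by (metis distrib_left mult.assoc)
    ultimately show ?thesis using s unfolding homog_cone_iff
      by (intro bexI[of _ "\<lambda>i. u * x i + (1 - u) * y i"]) auto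
  qed
qed

lemma homog_cone_zero: "P \<noteq> {} \<Longrightarrow> (\<lambda>j. 0) \<in> homog_cone P"
  unfolding homog_cone_iff by auto

lemma homog_cone_sum:
  assumes "convex_vecs P" "P \<noteq> {}" "\<And>t. t \<in> A \<Longrightarrow> f t \<in> homog_cone P"
  shows "(\<lambda>j. \<Sum>t\<in>A. f t j) \<in> homog_cone P"
  using assms(3)
proof (induction A rule: infinite_finite_induct)
  case (insert x A)
  then have "(\<lambda>j. f x j + (\<Sum>t\<in>A. f t j)) \<in> homog_cone P"
    by (intro homog_cone_add[OF assms(1)]) auto
  with insert show ?case by simp
qed (simp_all add: homog_cone_zero[OF assms(2)])

lemma LS_plus_lift_scale:
  assumes "Y \<in> LS_plus_lift V P" "0 \<le> t"
  shows "(\<lambda>i j. t * Y i j) \<in> LS_plus_lift V P"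
proof -
  have "(\<Sum>i\<in>I. \<Sum>j\<in>I. v i * (t * Y i j) * v j) = t * (\<Sum>i\<in>I. \<Sum>j\<in>I. v i * Y i j * v j)"
    for I v by (simp add: sum_distrib_left mult_ac)
  moreover have "(\<lambda>j. t * Y j None - t * Y j (Some i)) \<in> homog_cone P" if "i \<in> V" for i
    using homog_cone_scale[of "\<lambda>j. Y j None - Y j (Some i)" P t] assms that
    by (auto simp: LS_plus_lift_def algebra_simps)
  ultimately show ?thesis
    using assms by (auto simp: LS_plus_lift_def sym_psd_def mats_def fun_eq_iff
        intro!: homog_cone_scale)
qed

lemma LS_plus_lift_add:
  assumes P: "convex_vecs P" and "Y \<in> LS_plus_lift V P" "Z \<in> LS_plus_lift V P"
  shows "(\<lambda>i j. Y i j + Z i j) \<in> LS_plus_lift V P"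
proof -
  have "(\<Sum>i\<in>I. \<Sum>j\<in>I. v i * (Y i j + Z i j) * v j)
      = (\<Sum>i\<in>I. \<Sum>j\<in>I. v i * Y i j * v j) + (\<Sum>i\<in>I. \<Sum>j\<in>I. v i * Z i j * v j)"
    for I v by (simp add: sum.distrib algebra_simps)
  moreover have "(\<lambda>j. Y j None + Z j None - (Y j (Some i) + Z j (Some i))) \<in> homog_cone P"
    if "i \<in> V" for i
    using homog_cone_add[OF P, of "\<lambda>j. Y j None - Y j (Some i)" "\<lambda>j. Z j None - Z j (Some i)"]
      assms that by (auto simp: LS_plus_lift_def algebra_simps)
  ultimately show ?thesis
    using assms by (auto simp: LS_plus_lift_def sym_psd_def mats_def fun_eq_iff
        intro!: homog_cone_add)
qed

lemma convex_vecs_LS_plus: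
  assumes P: "convex_vecs P"
  shows "convex_vecs (LS_plus V P)"
  unfolding convex_vecs_def
proof (intro ballI allI impI)
  fix x y and u :: real
  assume x: "x \<in> LS_plus V P" and y: "y \<in> LS_plus V P" and u: "0 \<le> u" "u \<le> 1"
  obtain Y where Y: "Y \<in> LS_plus_lift V P" "(\<lambda>j. Y j None) = homog_vec 1 x"
    using x by (auto simp: LS_plus_def)
  obtain Z where Z: "Z \<in> LS_plus_lift V P" "(\<lambda>j. Z j None) = homog_vec 1 y"
    using y by (auto simp: LS_plus_def)
  let ?W = "\<lambda>i j. u * Y i j + (1 - u) * Z i j"
  have "?W \<in> LS_plus_lift V P"
    using LS_plus_lift_add[OF P LS_plus_lift_scale[OF Y(1), of u]
        LS_plus_lift_scale[OF Z(1), of "1 - u"]] u by simp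
  moreover have "?W j None = homog_vec 1 (\<lambda>i. u * x i + (1 - u) * y i) j" for j
    using fun_cong[OF Y(2), of j] fun_cong[OF Z(2), of j]
    by (cases j) (auto simp: homog_vec_def)
  ultimately show "(\<lambda>i. u * x i + (1 - u) * y i) \<in> LS_plus V P"
    using x y by (auto simp: LS_plus_def vecs_def intro!: bexI[of _ ?W])
qed

text \<open>Dividing \<open>Y\<close> by its corner entry makes it a lift of a point. Later lifts
  can therefore stay unnormalised sums over tight sets.\<close>

lemma LS_plus_lift_column_in_cone:
  assumes "Y \<in> LS_plus_lift V P" "Y None None > 0"
  shows "(\<lambda>j. Y j None) \<in> homog_cone (LS_plus V P)"
proof -
  define t where "t = Y None None"
  define x where "x i = Y (Some i) None / t" for i
  have t: "t > 0" using assms(2) by (simp add: t_def)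
  have "(\<lambda>i j. inverse t * Y i j) \<in> LS_plus_lift V P"
    using LS_plus_lift_scale[OF assms(1), of "inverse t"] t by simp
  moreover have "(\<lambda>j. inverse t * Y j None) = homog_vec 1 x"
    using t by (auto simp: fun_eq_iff homog_vec_def x_def t_def divide_inverse split: option.split)
  moreover have "x \<in> vecs V"
    using assms(1) by (auto simp: x_def vecs_def LS_plus_lift_def sym_psd_def mats_def homog_index_def)
  ultimately have "x \<in> LS_plus V P" unfolding LS_plus_def
    by (auto intro!: bexI[of _ "\<lambda>i j. inverse t * Y i j"])
  then show ?thesis using t unfolding homog_cone_iff
    by (intro bexI[of _ x]) (auto simp: x_def t_def)
qed

text \<open>For any vertex \<open>i\<close>, column 0 of the lift is the sum of the column of
  \<open>i\<close> and its complementary column, both in the cone over \<open>P\<close>.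
  Nonemptiness of \<open>V\<close> provides such an \<open>i\<close>.\<close>

lemma LS_plus_subset:
  assumes P: "convex_vecs P" and "V \<noteq> {}"
  shows "LS_plus V P \<subseteq> P"
proof
  fix x assume "x \<in> LS_plus V P"
  then obtain Y where Y: "Y \<in> LS_plus_lift V P" "(\<lambda>j. Y j None) = homog_vec 1 x"
    by (auto simp: LS_plus_def)
  obtain i where "i \<in> V" using assms by auto
  then have "(\<lambda>j. Y j (Some i) + (Y j None - Y j (Some i))) \<in> homog_cone P"
    using Y(1) by (intro homog_cone_add[OF P]) (auto simp: LS_plus_lift_def)
  then have "homog_vec 1 x \<in> homog_cone P" using Y(2) by simp
  then obtain z where "z \<in> P" "\<And>i. x i = z i"
    by (auto simp: homog_cone_iff homog_vec_def)
  then show "x \<in> P" by (metis ext)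
qed

lemma convex_vecs_FRAC: "convex_vecs (FRAC V E)"
  unfolding convex_vecs_def
proof (intro ballI allI impI)
  fix x y and u :: real
  assume x: "x \<in> FRAC V E" and y: "y \<in> FRAC V E" and u: "0 \<le> u" "u \<le> 1"
  have comb: "u * a + (1 - u) * b \<le> 1" if "a \<le> 1" "b \<le> 1" for a b :: real
    using convex_bound_le[OF that, of u "1 - u"] u by simp
  have "u * x i + (1 - u) * y i + (u * x j + (1 - u) * y j) \<le> 1"
    if "i \<in> V" "j \<in> V" "{i, j} \<in> E" for i j
    using comb[of "x i + x j" "y i + y j"] x y that by (auto simp: FRAC_def algebra_simps)
  with x y u comb show "(\<lambda>i. u * x i + (1 - u) * y i) \<in> FRAC V E"
    by (auto simp: FRAC_def vecs_def)
qed

lemma convex_vecs_LS_plus_iter: "convex_vecs ((LS_plus V ^^ k) (FRAC V E))"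
  by (induction k) (auto simp: convex_vecs_FRAC convex_vecs_LS_plus)

lemma LS_plus_iter_antimono:
  assumes "V \<noteq> {}" "j \<le> k"
  shows "(LS_plus V ^^ k) (FRAC V E) \<subseteq> (LS_plus V ^^ j) (FRAC V E)"
  by (rule lift_Suc_antimono_le[OF _ assms(2)])
    (simp add: LS_plus_subset[OF convex_vecs_LS_plus_iter assms(1)])

section \<open>Stable sets in the iterated relaxations\<close>

definition stable_set :: "'a set \<Rightarrow> 'a set set \<Rightarrow> 'a set \<Rightarrow> bool" where
  "stable_set V E S \<longleftrightarrow> S \<subseteq> V \<and> (\<forall>u\<in>S. \<forall>v\<in>S. {u, v} \<notin> E)"

definition chi :: "'a set \<Rightarrow> 'a option \<Rightarrow> real" where
  "chi S j = (case j of None \<Rightarrow> 1 | Some i \<Rightarrow> of_bool (i \<in> S))"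

lemma chi_simps [simp]: "chi S None = 1" "chi S (Some i) = of_bool (i \<in> S)"
  by (simp_all add: chi_def)

lemma quadratic_form_rank_one:
  fixes f g v :: "'a \<Rightarrow> real"
  shows "(\<Sum>i\<in>I. \<Sum>j\<in>I. v i * (f i * g j) * v j) = (\<Sum>i\<in>I. v i * f i) * (\<Sum>i\<in>I. v i * g i)"
  by (simp add: sum_product mult_ac)

text \<open>The rank-one matrix of \<open>chi S\<close> is a lift: the column of \<open>i\<close>
  and its complementary column are \<open>chi S\<close> and 0 in one order or the other, according
  to whether \<open>i\<close> is in \<open>S\<close>.\<close>

lemma stable_in_LS_plus_iter:
  assumes S: "stable_set V E S"
  shows "(\<lambda>i. of_bool (i \<in> S)) \<in> (LS_plus V ^^ k) (FRAC V E)"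
proof (induction k)
  case 0
  show ?case using S by (auto simp: FRAC_def vecs_def stable_set_def)
next
  case (Suc k)
  let ?P = "(LS_plus V ^^ k) (FRAC V E)"
  let ?Y = "\<lambda>i j. chi S i * chi S j"
  have chi: "chi S \<in> homog_cone ?P"
    using Suc unfolding homog_cone_iff by (intro bexI) auto
  have zero: "(\<lambda>j. 0) \<in> homog_cone ?P" using Suc by (intro homog_cone_zero) auto
  have out: "chi S j = 0" if "j \<notin> homog_index V" for j
    using that S by (cases j) (auto simp: homog_index_def stable_set_def)
  have "?Y \<in> LS_plus_lift V ?P"
    unfolding LS_plus_lift_def sym_psd_def mats_def mem_Collect_eq
  proof (intro conjI allI ballI)
    show "(\<lambda>j. ?Y j None) = (\<lambda>j. ?Y j j)"
      by (auto simp: fun_eq_iff chi_def split: option.split)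
  next
    fix v show "0 \<le> (\<Sum>i\<in>homog_index V. \<Sum>j\<in>homog_index V. v i * ?Y i j * v j)"
      by (simp add: quadratic_form_rank_one)
  next
    fix i show "(\<lambda>j. ?Y j (Some i)) \<in> homog_cone ?P"
      using chi zero by (cases "i \<in> S") auto
  next
    fix i show "(\<lambda>j. ?Y j None - ?Y j (Some i)) \<in> homog_cone ?P"
      using chi zero by (cases "i \<in> S") auto
  qed (auto simp: out)
  moreover have "(\<lambda>j. ?Y j None) = homog_vec 1 (\<lambda>i. of_bool (i \<in> S))"
    by (auto simp: fun_eq_iff homog_vec_def split: option.split)
  moreover have "(\<lambda>i. of_bool (i \<in> S)) \<in> vecs V"
    using S by (auto simp: vecs_def stable_set_def)
  ultimately show ?case unfolding funpow.simps comp_def LS_plus_def[of V ?P]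
    by (intro CollectI conjI bexI[of _ ?Y])
qed

lemma chi_in_homog_cone:
  assumes "stable_set V E S"
  shows "chi S \<in> homog_cone ((LS_plus V ^^ k) (FRAC V E))"
  unfolding homog_cone_iff by (rule bexI[OF _ stable_in_LS_plus_iter[OF assms]]) simp

section \<open>The graph\<close>

text \<open>For indices below \<open>2 * h + 1\<close>, this says that \<open>j - i\<close> modulo
  \<open>2 * h + 1\<close> lies in \<open>{1..h}\<close>; the second disjunct is the
  wrap-around.\<close>

definition arc :: "nat \<Rightarrow> nat \<Rightarrow> nat \<Rightarrow> bool" where
  "arc h i j \<longleftrightarrow> i < j \<and> j \<le> i + h \<or> j + h < i"

text \<open>The first disjunct gives the 4-cycle of an index. Residues modulo 4 that differ by
  exactly 2, without reduction, can only be 2 and 0 or 3 and 1, which gives the two families of arc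
  edges.\<close>

definition gadj :: "nat \<Rightarrow> nat \<Rightarrow> nat \<Rightarrow> bool" where
  "gadj h u v \<longleftrightarrow>
     u div 4 = v div 4 \<and> (u mod 4 = (v mod 4 + 1) mod 4 \<or> v mod 4 = (u mod 4 + 1) mod 4)
   \<or> u mod 4 = v mod 4 + 2 \<and> arc h (u div 4) (v div 4)
   \<or> v mod 4 = u mod 4 + 2 \<and> arc h (v div 4) (u div 4)"

definition gverts :: "nat \<Rightarrow> nat set" where
  "gverts h = {v. v div 4 < 2 * h + 1}"

definition gedges :: "nat \<Rightarrow> nat set set" where
  "gedges h = {{u, v} | u v. u \<in> gverts h \<and> v \<in> gverts h \<and> gadj h u v}"

lemma gverts_eq: "gverts h = {..<4 * (2 * h + 1)}"
  by (auto simp: gverts_def)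

lemma gadj_sym: "gadj h u v \<longleftrightarrow> gadj h v u"
  by (auto simp: gadj_def)

lemma gadj_irrefl: "\<not> gadj h u u"
proof -
  have "u mod 4 \<noteq> (u mod 4 + 1) mod 4" by presburger
  then show ?thesis by (auto simp: gadj_def)
qed

lemma gedges_iff:
  "{u, v} \<in> gedges h \<longleftrightarrow> u \<in> gverts h \<and> v \<in> gverts h \<and> gadj h u v"
  using gadj_sym by (auto simp: gedges_def doubleton_eq_iff)

lemma simple_graph_g: "simple_graph (gverts h) (gedges h)"
proof -
  have "gedges h \<subseteq> {{u, v} | u v. u \<in> gverts h \<and> v \<in> gverts h \<and> u \<noteq> v}"
    unfolding gedges_def using gadj_irrefl by blast
  then show ?thesis by (simp add: simple_graph_def gverts_eq)
qed

lemma arc_total: "i \<noteq> j \<Longrightarrow> arc h i j \<or> arc h j i"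
  and arc_asym: "arc h i j \<Longrightarrow> \<not> arc h j i"
  by (auto simp: arc_def)

lemma arc_neq: "arc h i j \<Longrightarrow> i \<noteq> j"
  by (auto simp: arc_def)

text \<open>The directions of the two diagonals, \<open>w\<close> with \<open>y\<close> and
  \<open>x\<close> with \<open>z\<close>, determine the arcs that are needed. In each of the four
  cases \<open>c\<close>, \<open>a\<close>, \<open>b\<close>, \<open>d\<close> are consecutive in
  the cyclic order \<open>w\<close>, \<open>x\<close>, \<open>y\<close>, \<open>z\<close>, and only
  the starting point varies.\<close>

lemma arc_diamond_sorted:
  assumes "w < x" "x < y" "y < z" "z < 2 * h + 1"
  obtains a b c d where "a \<in> {w, x, y, z}" "b \<in> {w, x, y, z}" "c \<in> {w, x, y, z}" "d \<in> {w, x, y, z}"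
    "a \<noteq> b" "arc h c a" "arc h c b" "arc h a d" "arc h b d"
proof -
  have "(arc h w x \<and> arc h w y \<and> arc h x z \<and> arc h y z)
      \<or> (arc h x y \<and> arc h x z \<and> arc h y w \<and> arc h z w)
      \<or> (arc h y z \<and> arc h y w \<and> arc h z x \<and> arc h w x)
      \<or> (arc h z w \<and> arc h z x \<and> arc h w y \<and> arc h x y)"
    using assms unfolding arc_def by (cases "y \<le> w + h"; cases "z \<le> x + h") auto
  then show thesis
    apply (elim disjE conjE)
    subgoal by (rule that[of x y w z]) (use assms in simp_all)
    subgoal by (rule that[of y z x w]) (use assms in simp_all)
    subgoal by (rule that[of z w y x]) (use assms in simp_all)
    subgoal by (rule that[of w x z y]) (use assms in simp_all)
    done
qed


lemma arc_diamond:
  assumes "I \<subseteq> {..<2 * h + 1}" "card I \<ge> 4"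
  obtains a b c d where "a \<in> I" "b \<in> I" "c \<in> I" "d \<in> I"
    "a \<noteq> b" "arc h c a" "arc h c b" "arc h a d" "arc h b d"
proof -
  obtain J where J: "J \<subseteq> I" "card J = 4" "finite J"
    using obtain_subset_with_card_n[OF assms(2)] by metis
  define xs where "xs = sorted_list_of_set J"
  have xs: "length xs = 4" "sorted_wrt (<) xs" "set xs = J"
    using J by (simp_all add: xs_def)
  then obtain w x y z where "xs = [w, x, y, z]"
    by (auto simp: numeral_eq_Suc length_Suc_conv)
  with xs(2) xs(3) have s: "w < x" "x < y" "y < z" "{w, x, y, z} \<subseteq> I" "{w, x, y, z} = J"
    using J(1) by auto
  have z: "z < 2 * h + 1" using s(4) assms(1) by auto
  obtain a b c d where
    "a \<in> {w, x, y, z}" "b \<in> {w, x, y, z}" "c \<in> {w, x, y, z}" "d \<in> {w, x, y, z}"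
    "a \<noteq> b" "arc h c a" "arc h c b" "arc h a d" "arc h b d"
    by (rule arc_diamond_sorted[OF s(1-3) z])
  then show thesis using s(4) by (intro that[of a b c d]) auto
qed

section \<open>Automorphisms and vertex-transitivity\<close>

definition shift :: "nat \<Rightarrow> nat \<Rightarrow> nat \<Rightarrow> nat" where
  "shift h t i = (if i + t < 2 * h + 1 then i + t else i + t - (2 * h + 1))"

text \<open>The map \<open>t - i\<close> modulo \<open>2 * h + 1\<close> reverses all arcs. It is
  paired with \<open>flip2\<close>, which swaps layers 0 and 2 and layers 1 and 3 and so undoes the
  reversal; rotations are paired with maps that keep the direction.\<close>

definition reflect :: "nat \<Rightarrow> nat \<Rightarrow> nat \<Rightarrow> nat" where
  "reflect h t i = (if i \<le> t then t - i else t + (2 * h + 1) - i)"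

definition flip1 :: "nat \<Rightarrow> nat" where
  "flip1 p = (if even p then p + 1 else p - 1)"

definition flip2 :: "nat \<Rightarrow> nat" where
  "flip2 p = (if p < 2 then p + 2 else p - 2)"

definition on_codes :: "(nat \<Rightarrow> nat) \<Rightarrow> (nat \<Rightarrow> nat) \<Rightarrow> nat \<Rightarrow> nat" where
  "on_codes f g v = 4 * f (v div 4) + g (v mod 4)"

lemma less_4_cases: "(p::nat) < 4 \<Longrightarrow> p = 0 \<or> p = 1 \<or> p = 2 \<or> p = 3"
  by linarith

lemma graph_automorphism_on_codes:
  assumes f: "\<And>i. i < 2 * h + 1 \<Longrightarrow> f i < 2 * h + 1"
    and f_inj: "inj_on f {..<2 * h + 1}"
    and g: "\<And>p. p < 4 \<Longrightarrow> g p < 4"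
    and g_inj: "inj_on g {..<4}"
    and adj: "\<And>i j p q. i < 2 * h + 1 \<Longrightarrow> j < 2 * h + 1 \<Longrightarrow> p < 4 \<Longrightarrow> q < 4 \<Longrightarrow>
      gadj h (4 * f i + g p) (4 * f j + g q) \<longleftrightarrow> gadj h (4 * i + p) (4 * j + q)"
  shows "graph_automorphism (gverts h) (gedges h) (on_codes f g)"
proof -
  have dm: "on_codes f g v div 4 = f (v div 4)" "on_codes f g v mod 4 = g (v mod 4)" for v
  proof -
    have "g (v mod 4) < 4" by (rule g) simp
    then show "on_codes f g v div 4 = f (v div 4)" "on_codes f g v mod 4 = g (v mod 4)"
      by (simp_all add: on_codes_def)
  qed
  have into: "on_codes f g ` gverts h \<subseteq> gverts h"
  proof (rule image_subsetI)
    fix v assume "v \<in> gverts h"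
    then have "f (v div 4) < 2 * h + 1" unfolding gverts_def by (intro f) blast
    then show "on_codes f g v \<in> gverts h" unfolding gverts_def mem_Collect_eq dm .
  qed
  have inj: "inj_on (on_codes f g) (gverts h)"
  proof (rule inj_onI)
    fix u v assume uv: "u \<in> gverts h" "v \<in> gverts h" "on_codes f g u = on_codes f g v"
    then have "f (u div 4) = f (v div 4)" "g (u mod 4) = g (v mod 4)"
      by (metis dm(1), metis dm(2))
    moreover have "u div 4 \<in> {..<2 * h + 1}" "v div 4 \<in> {..<2 * h + 1}"
      using uv(1,2) unfolding gverts_def by blast+
    moreover have "u mod 4 \<in> {..<4}" "v mod 4 \<in> {..<4}" by simp_all
    ultimately have "u div 4 = v div 4" "u mod 4 = v mod 4"
      using inj_onD[OF f_inj] inj_onD[OF g_inj] by blast+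
    then show "u = v" by (metis div_mult_mod_eq)
  qed
  have "on_codes f g ` gverts h = gverts h"
    using into inj by (intro endo_inj_surj) (auto simp: gverts_eq)
  moreover have "gadj h (on_codes f g u) (on_codes f g v) \<longleftrightarrow> gadj h u v"
    if "u \<in> gverts h" "v \<in> gverts h" for u v
  proof -
    have "u div 4 < 2 * h + 1" "v div 4 < 2 * h + 1" using that unfolding gverts_def by blast+
    from adj[OF this, of "u mod 4" "v mod 4"] show ?thesis by (simp add: on_codes_def)
  qed
  ultimately show ?thesis
    using inj into unfolding graph_automorphism_def bij_betw_def gedges_iff by blast
qed

lemma arc_shift:
  assumes "i < 2 * h + 1" "j < 2 * h + 1" "t < 2 * h + 1"
  shows "arc h (shift h t i) (shift h t j) \<longleftrightarrow> arc h i j"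
  using assms unfolding arc_def shift_def
  by (cases "i + t < 2 * h + 1"; cases "j + t < 2 * h + 1") auto

lemma arc_reflect:
  assumes "i < 2 * h + 1" "j < 2 * h + 1" "t < 2 * h + 1"
  shows "arc h (reflect h t i) (reflect h t j) \<longleftrightarrow> arc h j i"
  using assms unfolding arc_def reflect_def
  by (cases "i \<le> t"; cases "j \<le> t") auto

lemma inj_shift: "inj_on (shift h t) {..<2 * h + 1}"
  by (auto simp: inj_on_def shift_def split: if_splits)

lemma inj_reflect: "t < 2 * h + 1 \<Longrightarrow> inj_on (reflect h t) {..<2 * h + 1}"
  by (auto simp: inj_on_def reflect_def split: if_splits)

lemma gadj_code:
  assumes "p < 4" "q < 4"
  shows "gadj h (4 * i + p) (4 * j + q) \<longleftrightarrow>
     i = j \<and> (p = (q + 1) mod 4 \<or> q = (p + 1) mod 4)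
   \<or> p = q + 2 \<and> arc h i j \<or> q = p + 2 \<and> arc h j i"
  using assms by (simp add: gadj_def)

lemma flip_less: "p < 4 \<Longrightarrow> flip1 p < 4" "p < 4 \<Longrightarrow> flip2 p < 4"
  by (auto simp: flip1_def flip2_def dest!: less_4_cases)

lemma inj_flip: "inj_on flip1 {..<4}" "inj_on flip2 {..<4}"
  by (auto simp: inj_on_def flip1_def flip2_def dest!: less_4_cases)

lemma flip1_cyclic:
  assumes "p < 4" "q < 4"
  shows "flip1 p = (flip1 q + 1) mod 4 \<or> flip1 q = (flip1 p + 1) mod 4 \<longleftrightarrow>
      p = (q + 1) mod 4 \<or> q = (p + 1) mod 4"
  using less_4_cases[OF assms(1)] less_4_cases[OF assms(2)]
  by (elim disjE) (simp_all add: flip1_def)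

lemma flip1_opposite:
  assumes "p < 4" "q < 4"
  shows "flip1 p = flip1 q + 2 \<longleftrightarrow> p = q + 2"
  using less_4_cases[OF assms(1)] less_4_cases[OF assms(2)]
  by (elim disjE) (simp_all add: flip1_def)

lemma flip2_cyclic:
  assumes "p < 4" "q < 4"
  shows "flip2 p = (flip2 q + 1) mod 4 \<or> flip2 q = (flip2 p + 1) mod 4 \<longleftrightarrow>
      p = (q + 1) mod 4 \<or> q = (p + 1) mod 4"
  using less_4_cases[OF assms(1)] less_4_cases[OF assms(2)]
  by (elim disjE) (simp_all add: flip2_def)

lemma flip2_opposite:
  assumes "p < 4" "q < 4"
  shows "flip2 p = flip2 q + 2 \<longleftrightarrow> q = p + 2"
  using less_4_cases[OF assms(1)] less_4_cases[OF assms(2)]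
  by (elim disjE) (simp_all add: flip2_def)

lemma automorphism_shift:
  assumes t: "t < 2 * h + 1" and g: "g = id \<or> g = flip1"
  shows "graph_automorphism (gverts h) (gedges h) (on_codes (shift h t) g)"
proof -
  have g_less: "g p < 4" if "p < 4" for p using g flip_less that by auto
  show ?thesis
  proof (rule graph_automorphism_on_codes)
    show "inj_on (shift h t) {..<2 * h + 1}" by (rule inj_shift)
    show "inj_on g {..<4}" using g inj_flip by auto
    show "g p < 4" if "p < 4" for p by (rule g_less[OF that])
    show "shift h t i < 2 * h + 1" if "i < 2 * h + 1" for i
      using that t by (auto simp: shift_def)
    fix i j p q :: nat
    assume ij: "i < 2 * h + 1" "j < 2 * h + 1" and pq: "p < 4" "q < 4"
    have eq: "shift h t i = shift h t j \<longleftrightarrow> i = j"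
      using inj_shift ij by (auto simp: inj_on_def)
    note code = gadj_code[OF pq] gadj_code[OF g_less[OF pq(1)] g_less[OF pq(2)]] eq
      arc_shift[OF ij t] arc_shift[OF ij(2) ij(1) t]
    from g show "gadj h (4 * shift h t i + g p) (4 * shift h t j + g q)
        \<longleftrightarrow> gadj h (4 * i + p) (4 * j + q)"
    proof
      assume g1: "g = id"
      show ?thesis unfolding code unfolding g1 id_apply ..
    next
      assume g1: "g = flip1"
      show ?thesis unfolding code unfolding g1 flip1_cyclic[OF pq] flip1_opposite[OF pq]
        flip1_opposite[OF pq(2) pq(1)] ..
    qed
  qed
qed

lemma automorphism_reflect:
  assumes t: "t < 2 * h + 1" and g: "g = flip2 \<or> g = flip1 \<circ> flip2"
  shows "graph_automorphism (gverts h) (gedges h) (on_codes (reflect h t) g)"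
proof -
  have g_less: "g p < 4" if "p < 4" for p using g flip_less that by auto
  show ?thesis
  proof (rule graph_automorphism_on_codes)
    show "inj_on (reflect h t) {..<2 * h + 1}" by (rule inj_reflect[OF t])
    have "inj_on flip1 (flip2 ` {..<4})"
      by (rule inj_on_subset[OF inj_flip(1)]) (auto intro: flip_less)
    then have "inj_on (flip1 \<circ> flip2) {..<4}"
      by (rule comp_inj_on[OF inj_flip(2)])
    then show "inj_on g {..<4}" using g inj_flip by auto
    show "g p < 4" if "p < 4" for p by (rule g_less[OF that])
    show "reflect h t i < 2 * h + 1" if "i < 2 * h + 1" for i
      using that t by (auto simp: reflect_def)
    fix i j p q :: nat
    assume ij: "i < 2 * h + 1" "j < 2 * h + 1" and pq: "p < 4" "q < 4"
    have eq: "reflect h t i = reflect h t j \<longleftrightarrow> i = j"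
      using inj_reflect[OF t] ij by (auto simp: inj_on_def)
    note code = gadj_code[OF pq] gadj_code[OF g_less[OF pq(1)] g_less[OF pq(2)]] eq
      arc_reflect[OF ij t] arc_reflect[OF ij(2) ij(1) t]
    note fl = flip_less(2)[OF pq(1)] flip_less(2)[OF pq(2)]
    note cyc = flip1_cyclic[OF fl] flip1_opposite[OF fl] flip1_opposite[OF fl(2) fl(1)]
      flip2_cyclic[OF pq] flip2_opposite[OF pq] flip2_opposite[OF pq(2) pq(1)]
    from g show "gadj h (4 * reflect h t i + g p) (4 * reflect h t j + g q)
        \<longleftrightarrow> gadj h (4 * i + p) (4 * j + q)"
    proof
      assume g2: "g = flip2"
      show ?thesis unfolding code unfolding g2 cyc by blast
    next
      assume g2: "g = flip1 \<circ> flip2"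
      show ?thesis unfolding code unfolding g2 comp_apply cyc by blast
    qed
  qed
qed

text \<open>A rotation and a reflection each take index \<open>i\<close> to index \<open>j\<close>,
  and the four maps \<open>id\<close>, \<open>flip1\<close>, \<open>flip2\<close>,
  \<open>flip1 \<circ> flip2\<close> act transitively on the layers. The layers decide which of the
  two index maps is used.\<close>

lemma vertex_transitive_g: "vertex_transitive (gverts h) (gedges h)"
  unfolding vertex_transitive_def
proof (intro ballI)
  fix u v assume "u \<in> gverts h" "v \<in> gverts h"
  define i j p q where "i = u div 4" "j = v div 4" "p = u mod 4" "q = v mod 4"
  have ij: "i < 2 * h + 1" "j < 2 * h + 1" and pq: "p < 4" "q < 4"
    and v: "v = 4 * j + q"
    using \<open>u \<in> gverts h\<close> \<open>v \<in> gverts h\<close> unfolding gverts_def i_j_p_q_def by simp_all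
  have oc: "on_codes f g u = v" if "f i = j" "g p = q" for f g
    unfolding on_codes_def v i_j_p_q_def(1,3)[symmetric] that ..
  define s where "s = (if i \<le> j then j - i else j + (2 * h + 1) - i)"
  define r where "r = (if i + j < 2 * h + 1 then i + j else i + j - (2 * h + 1))"
  have s: "s < 2 * h + 1" "shift h s i = j" using ij by (auto simp: s_def shift_def)
  have r: "r < 2 * h + 1" "reflect h r i = j" using ij by (auto simp: r_def reflect_def)
  have "id p = q \<or> flip1 p = q \<or> flip2 p = q \<or> (flip1 \<circ> flip2) p = q"
    using less_4_cases[OF pq(1)] less_4_cases[OF pq(2)]
    by (elim disjE) (simp_all add: flip1_def flip2_def)
  then show "\<exists>f. graph_automorphism (gverts h) (gedges h) f \<and> f u = v"
    using oc[of "shift h s", OF s(2)] oc[of "reflect h r", OF r(2)] automorphism_shift[OF s(1)] automorphism_reflect[OF r(1)]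
    by (elim disjE) blast+
qed

section \<open>A point of the hierarchy outside the stable set polytope\<close>

definition mids :: "nat \<Rightarrow> nat set" where
  "mids h = {v \<in> gverts h. v mod 4 = 1}"

text \<open>
  The tight sets of the inequality \<open>x(layers 0, 1, 2) \<le> 2h + 2\<close> that are used, for \<open>t = (l, b)\<close>: index \<open>l\<close>
  contributes both its ends, every other index its middle vertex, except that \<open>b \<noteq> l\<close>
  contributes instead the end not adjacent to the ends of \<open>l\<close>.
\<close>
definition tset :: "nat \<Rightarrow> nat \<times> nat \<Rightarrow> nat set" where
  "tset h t = {v \<in> gverts h.
     v div 4 = fst t \<and> v mod 4 \<in> {0, 2}
   \<or> v div 4 \<noteq> fst t \<and> v div 4 \<noteq> snd t \<and> v mod 4 = 1
   \<or> v div 4 = snd t \<and> v div 4 \<noteq> fst t \<and> v mod 4 = (if arc h (snd t) (fst t) then 0 else 2)}"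

lemma Suc_mult_4_div_mod [simp]:
  "Suc (4 * i) div 4 = i" "Suc (Suc (4 * i)) div 4 = i" "Suc (Suc (4 * i)) mod 4 = 2"
  "\<not> 4 dvd Suc (Suc (4 * i))"
  by presburger+

lemma stable_mono: "stable_set V E S \<Longrightarrow> S' \<subseteq> S \<Longrightarrow> stable_set V E S'"
  by (auto simp: stable_set_def)

lemma stable_mids: "stable_set (gverts h) (gedges h) (mids h)"
  by (auto simp: stable_set_def mids_def gedges_iff gadj_def)

text \<open>Layer 3 does not occur, and no index contributes both its middle and an end. So an edge
  would join layer 2 to layer 0 between the indices \<open>fst t\<close> and \<open>snd t\<close>,
  and the end of \<open>snd t\<close> is chosen against the direction of their arc.\<close>

lemma stable_tset: "stable_set (gverts h) (gedges h) (tset h t)"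
proof -
  have "\<not> gadj h u v" if "u \<in> tset h t" "v \<in> tset h t" for u v
  proof -
    have irrefl: "\<not> arc h i i" for i by (simp add: arc_def)
    have same: "\<not> (u div 4 = v div 4 \<and> u mod 4 = (v mod 4 + 1) mod 4)"
      if "u \<in> tset h t" "v \<in> tset h t" for u v
      using that by (auto simp: tset_def split: if_splits)
    have opp: "\<not> (u mod 4 = v mod 4 + 2 \<and> arc h (u div 4) (v div 4))"
      if "u \<in> tset h t" "v \<in> tset h t" for u v
    proof
      assume uv: "u mod 4 = v mod 4 + 2 \<and> arc h (u div 4) (v div 4)"
      have "u mod 4 = 0 \<or> u mod 4 = 1 \<or> u mod 4 = 2"
        using that(1) by (auto simp: tset_def split: if_splits)
      with uv have "u mod 4 = 2" "v mod 4 = 0" by linarith+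
      with that have "u div 4 = fst t \<or> u div 4 = snd t \<and> \<not> arc h (snd t) (fst t)"
        "v div 4 = fst t \<or> v div 4 = snd t \<and> arc h (snd t) (fst t)"
        by (auto simp: tset_def split: if_splits)
      with uv irrefl show False by (metis arc_asym)
    qed
    show ?thesis
      using same[OF that] same[OF that(2,1)] opp[OF that] opp[OF that(2,1)]
      unfolding gadj_def by metis
  qed
  then show ?thesis by (auto simp: stable_set_def gedges_iff) (auto simp: tset_def)
qed

text \<open>The first difference is the middle of \<open>b\<close> minus its end in layer 0, because
  \<open>b\<close> has an arc to \<open>d\<close>; the second is the middle minus the end in layer
  2, because \<open>c\<close> has an arc to \<open>b\<close>. The third is both ends minus the
  middle. The sum leaves one copy of the middle, and coordinate \<open>None\<close> cancels.\<close>

lemma mid_as_combination: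
  assumes "b < 2 * h + 1" "arc h c b" "arc h b d"
  shows "of_bool (j = Some (4 * b + 1)) =
    chi (tset h (d, d)) j - chi (tset h (d, b)) j + chi (tset h (c, c)) j - chi (tset h (c, b)) j
    + chi (tset h (b, b)) j - chi (mids h) j"
proof (cases j)
  case (Some v)
  have v: "v = 4 * b + 1 \<longleftrightarrow> v \<in> gverts h \<and> v div 4 = b \<and> v mod 4 = 1"
  proof
    assume "v = 4 * b + 1"
    then show "v \<in> gverts h \<and> v div 4 = b \<and> v mod 4 = 1"
      using assms(1) by (simp add: gverts_def)
  next
    assume "v \<in> gverts h \<and> v div 4 = b \<and> v mod 4 = 1"
    then show "v = 4 * b + 1" using div_mult_mod_eq[of v 4] by linarith
  qed
  have ne: "b \<noteq> c" "b \<noteq> d" "\<not> arc h b c"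
    using arc_neq[OF assms(2)] arc_neq[OF assms(3)] arc_asym[OF assms(2)] by auto
  show ?thesis
    unfolding Some option.inject v using ne assms(3)
    by (cases "v \<in> gverts h"; cases "v div 4 = b") (auto simp: tset_def mids_def)
qed simp

section \<open>Conic combinations of tight sets\<close>

abbreviation lscone :: "nat \<Rightarrow> nat \<Rightarrow> (nat option \<Rightarrow> real) set" where
  "lscone h k \<equiv> homog_cone ((LS_plus (gverts h) ^^ k) (FRAC (gverts h) (gedges h)))"

lemma lscone_add: "a \<in> lscone h k \<Longrightarrow> b \<in> lscone h k \<Longrightarrow> (\<lambda>j. a j + b j) \<in> lscone h k"
  by (rule homog_cone_add[OF convex_vecs_LS_plus_iter])

lemma lscone_chi: "stable_set (gverts h) (gedges h) S \<Longrightarrow> 0 \<le> r \<Longrightarrow> (\<lambda>j. r * chi S j) \<in> lscone h k"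
  by (intro homog_cone_scale chi_in_homog_cone)

lemma lscone_sum:
  assumes "\<And>t. t \<in> A \<Longrightarrow> 0 \<le> c t"
  shows "(\<lambda>j. \<Sum>t\<in>A. c t * chi (tset h t) j) \<in> lscone h k"
proof (rule homog_cone_sum[OF convex_vecs_LS_plus_iter])
  show "(LS_plus (gverts h) ^^ k) (FRAC (gverts h) (gedges h)) \<noteq> {}"
    using stable_in_LS_plus_iter[OF stable_mids] by blast
  show "(\<lambda>j. c t * chi (tset h t) j) \<in> lscone h k" if "t \<in> A" for t
    by (rule lscone_chi[OF stable_tset assms[OF that]])
qed

text \<open>Split off \<open>r\<close> copies of the base point: the remaining coefficients of the
  tight sets are nonnegative, and the surplus \<open>r * e - s\<close> is a nonnegative multiple of
  the stable set \<open>mids h\<close>.\<close>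

lemma lscone_combination:
  assumes fin: "finite A" and sub: "B \<subseteq> A"
    and base: "(\<lambda>j. (\<Sum>t\<in>B. chi (tset h t) j) - e * chi (mids h) j) \<in> lscone h k"
    and c: "\<And>t. t \<in> B \<Longrightarrow> r \<le> c t" "\<And>t. t \<in> A \<Longrightarrow> 0 \<le> c t"
    and r: "0 \<le> r" "s \<le> r * e"
  shows "(\<lambda>j. (\<Sum>t\<in>A. c t * chi (tset h t) j) - s * chi (mids h) j) \<in> lscone h k"
proof -
  let ?c = "\<lambda>t. c t - r * of_bool (t \<in> B)"
  have "(\<lambda>j. (\<Sum>t\<in>A. ?c t * chi (tset h t) j)
      + (r * ((\<Sum>t\<in>B. chi (tset h t) j) - e * chi (mids h) j) + (r * e - s) * chi (mids h) j))
      \<in> lscone h k"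
    using c r by (intro lscone_add lscone_sum homog_cone_scale[OF base] lscone_chi stable_mids) auto
  moreover have "(\<Sum>t\<in>A. ?c t * chi (tset h t) j)
      = (\<Sum>t\<in>A. c t * chi (tset h t) j) - r * (\<Sum>t\<in>B. chi (tset h t) j)" for j
  proof -
    have "(\<Sum>t\<in>A. of_bool (t \<in> B) * chi (tset h t) j) = (\<Sum>t\<in>B. chi (tset h t) j)"
      using fin sub by (intro sum.mono_neutral_cong_right) auto
    then show ?thesis
      by (simp add: left_diff_distrib sum_subtractf mult.assoc flip: sum_distrib_left)
  qed
  ultimately show ?thesis by (simp add: algebra_simps)
qed

lemma tset_mid_iff:
  assumes "i < 2 * h + 1"
  shows "4 * i + 1 \<in> tset h t \<longleftrightarrow> i \<noteq> fst t \<and> i \<noteq> snd t"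
  using assms by (auto simp: tset_def gverts_def)

lemma sum_add_scaled_coeffs:
  fixes e :: real
  shows "(\<Sum>t\<in>A. (f t + e * g t) * u t) = (\<Sum>t\<in>A. f t * u t) + e * (\<Sum>t\<in>A. g t * u t)"
  by (simp add: distrib_right sum.distrib sum_distrib_left mult.assoc)

text \<open>
  Substituting the combination for the unit vector of the middle vertex of \<open>b\<close> turns the column
  of the middle vertex of \<open>a\<close> into a perturbation of the point for \<open>I - {a}\<close>.
\<close>
lemma mid_columns_in_lscone:
  assumes I: "finite I" "I \<subseteq> {..<2 * h + 1}" "a \<in> I" "b \<in> I" "c \<in> I" "d \<in> I" "a \<noteq> b"
    and arcs: "arc h c a" "arc h c b" "arc h a d" "arc h b d"
    and base: "(\<lambda>j. (\<Sum>t\<in>(I - {a}) \<times> (I - {a}). chi (tset h t) j) - 4 * e * chi (mids h) j)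
      \<in> lscone h k"
    and e: "0 \<le> e" "e \<le> 1 / 4"
  shows "(\<lambda>j. (\<Sum>t\<in>I \<times> I. chi (tset h t) (Some (4 * a + 1)) * chi (tset h t) j)
      - e * chi (mids h) j + e * of_bool (j = Some (4 * b + 1))) \<in> lscone h k" (is ?A)
    and "(\<lambda>j. (\<Sum>t\<in>I \<times> I. (1 - chi (tset h t) (Some (4 * a + 1))) * chi (tset h t) j)
      - e * of_bool (j = Some (4 * b + 1))) \<in> lscone h k" (is ?B)
proof -
  have lt: "a < 2 * h + 1" "b < 2 * h + 1" using I by auto
  have ne: "c \<noteq> a" "c \<noteq> b" "a \<noteq> d" "b \<noteq> d" "c \<noteq> d"
    using arcs arc_neq arc_asym by metis+
  let ?m = "\<lambda>t. chi (tset h t) (Some (4 * a + 1))"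
  \<comment> \<open>The coefficients of the tight sets in \<open>mid_as_combination\<close> for
    \<open>b\<close>. The \<open>mids\<close> term of that identity raises the subtracted multiple
    of \<open>mids\<close> from \<open>e\<close> to \<open>2 * e\<close>.\<close>
  let ?w = "\<lambda>t. of_bool (t = (d, d)) - of_bool (t = (d, b)) + of_bool (t = (c, c))
    - of_bool (t = (c, b)) + of_bool (t = (b, b)) :: real"
  have m: "?m t = of_bool (a \<noteq> fst t \<and> a \<noteq> snd t)" for t
    using tset_mid_iff[OF lt(1)] by simp
  have w: "(\<Sum>t\<in>I \<times> I. ?w t * chi (tset h t) j) =
    chi (tset h (d, d)) j - chi (tset h (d, b)) j + chi (tset h (c, c)) j - chi (tset h (c, b)) j
    + chi (tset h (b, b)) j" for j
    using I by (simp add: distrib_right left_diff_distrib sum.distrib sum_subtractf)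
  have "(\<lambda>j. (\<Sum>t\<in>I \<times> I. (?m t + e * ?w t) * chi (tset h t) j) - 2 * e * chi (mids h) j)
      \<in> lscone h k"
  proof (rule lscone_combination[OF _ _ base])
    \<comment> \<open>Half of the base point accounts for exactly
      \<open>1 / 2 * (4 * e) = 2 * e\<close> copies of \<open>mids\<close>. On pairs avoiding
      \<open>a\<close> the coefficient is at least \<open>1 - e\<close>, so half a copy of each
      tight set is available.\<close>
    show half: "1 / 2 \<le> ?m t + e * ?w t" if "t \<in> (I - {a}) \<times> (I - {a})" for t
    proof -
      have "?w t \<ge> -1" using ne by auto
      then have "e * ?w t \<ge> e * (-1)" using e(1) by (intro mult_left_mono)
      moreover have "?m t = 1" using that m by auto
      ultimately show ?thesis using e by linarith
    qed
    \<comment> \<open>The five pairs carrying \<open>?w\<close> all avoid \<open>a\<close>, so off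
      \<open>I - {a}\<close> squared only the nonnegative \<open>?m\<close> remains.\<close>
    show "0 \<le> ?m t + e * ?w t" if "t \<in> I \<times> I" for t
    proof (cases "t \<in> (I - {a}) \<times> (I - {a})")
      case True
      from half[OF True] show ?thesis by linarith
    next
      case False
      with that have "?w t = 0" using ne I by auto
      then show ?thesis by simp
    qed
  qed (use I in auto)
  moreover have "(\<Sum>t\<in>I \<times> I. (?m t + e * ?w t) * chi (tset h t) j) - 2 * e * chi (mids h) j
      = (\<Sum>t\<in>I \<times> I. ?m t * chi (tset h t) j) - e * chi (mids h) j
        + e * of_bool (j = Some (4 * b + 1))" for j
  proof -
    have "(\<Sum>t\<in>I \<times> I. (?m t + e * ?w t) * chi (tset h t) j)
        = (\<Sum>t\<in>I \<times> I. ?m t * chi (tset h t) j) + e * (\<Sum>t\<in>I \<times> I. ?w t * chi (tset h t) j)"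
      by (rule sum_add_scaled_coeffs)
    then show ?thesis
      unfolding w mid_as_combination[OF lt(2) arcs(2,4)] by (simp only: algebra_simps)
  qed
  ultimately show ?A by (simp only:)
  \<comment> \<open>The tight set of \<open>(a, a)\<close> misses the middle of \<open>a\<close>, so
    it has coefficient 1. Replacing a fraction \<open>e\<close> of it by the stable subset without
    the middle of \<open>b\<close> subtracts the unit vector.\<close>
  let ?S = "tset h (a, a) - {4 * b + 1}"
  have b: "4 * b + 1 \<in> tset h (a, a)" using tset_mid_iff[OF lt(2)] I by simp
  have "(\<lambda>j. (\<Sum>t\<in>I \<times> I. (1 - ?m t - e * of_bool (t = (a, a))) * chi (tset h t) j)
      + e * chi ?S j) \<in> lscone h k"
    using e m by (intro lscone_add lscone_sum lscone_chi stable_mono[OF stable_tset]) auto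
  moreover have "(\<Sum>t\<in>I \<times> I. (1 - ?m t - e * of_bool (t = (a, a))) * chi (tset h t) j)
      + e * chi ?S j = (\<Sum>t\<in>I \<times> I. (1 - ?m t) * chi (tset h t) j)
      - e * of_bool (j = Some (4 * b + 1))" for j
  proof -
    have "(\<Sum>t\<in>I \<times> I. (1 - ?m t - e * of_bool (t = (a, a))) * chi (tset h t) j)
        = (\<Sum>t\<in>I \<times> I. (1 - ?m t) * chi (tset h t) j)
          - e * (\<Sum>t\<in>I \<times> I. of_bool (t = (a, a)) * chi (tset h t) j)"
      using sum_add_scaled_coeffs[of "\<lambda>t. 1 - ?m t" "- e"] by simp
    moreover have "(\<Sum>t\<in>I \<times> I. of_bool (t = (a, a)) * chi (tset h t) j) = chi (tset h (a, a)) j"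
      using I by simp
    moreover have "chi ?S j = chi (tset h (a, a)) j - of_bool (j = Some (4 * b + 1))"
      using b by (cases j) auto
    ultimately show ?thesis by (simp only: right_diff_distrib)
  qed
  ultimately show ?B by (simp only:)
qed


text \<open>Each tight set meets an edge at most once, while the bound after homogenising is
  \<open>N - e\<close>. If an endpoint is in \<open>mids h\<close>, the subtraction supplies the
  missing \<open>e\<close>; otherwise a set \<open>tset h (l, l)\<close> with \<open>l\<close> away
  from both endpoints misses the edge and saves 1. Three indices guarantee such an
  \<open>l\<close>.\<close>

lemma tset_sum_in_lscone_0:
  assumes I: "finite I" "I \<subseteq> {..<2 * h + 1}" "card I \<ge> 3" and e: "0 \<le> e" "e \<le> 1"
  shows "(\<lambda>j. (\<Sum>t\<in>I \<times> I. chi (tset h t) j) - e * chi (mids h) j) \<in> lscone h 0"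
proof -
  let ?T = "I \<times> I"
  let ?y = "\<lambda>v. (\<Sum>t\<in>?T. of_bool (v \<in> tset h t)) - e * of_bool (v \<in> mids h)"
  define N where "N = real (card ?T)"
  have fin: "finite ?T" using I by simp
  have "card I * card I \<ge> 3 * 3" using I(3) by (intro mult_le_mono)
  then have "real 9 \<le> N" unfolding N_def card_cartesian_product of_nat_le_iff by simp
  then have N: "N \<ge> 9" by simp
  have other: "\<exists>l\<in>I. l \<noteq> i \<and> l \<noteq> j" for i j
  proof (rule ccontr)
    assume "\<not> ?thesis"
    then have "I \<subseteq> {i, j}" by auto
    then have "card I \<le> card {i, j}" by (intro card_mono) auto
    also have "\<dots> \<le> 2" by (simp add: card_insert_if)
    finally show False using I(3) by simp
  qed
  have le_N: "sum g ?T \<le> N" if "\<And>t. g t \<le> 1" for g :: "nat \<times> nat \<Rightarrow> real"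
    using sum_bounded_above[of ?T g 1] that by (simp add: N_def)
  have le_N1: "sum g ?T \<le> N - 1" if "\<And>t. g t \<le> 1" "s \<in> ?T" "g s \<le> 0"
    for g :: "nat \<times> nat \<Rightarrow> real" and s
  proof -
    have "sum g ?T = g s + sum g (?T - {s})" using that fin by (intro sum.remove)
    moreover have "sum g (?T - {s}) \<le> real (card (?T - {s}))"
      using sum_bounded_above[of "?T - {s}" g 1] that by simp
    moreover have "card (?T - {s}) = card ?T - 1" "card ?T \<ge> 1"
      using that fin by (auto simp: card_gt_0_iff Suc_le_eq)
    ultimately show ?thesis using that by (simp add: N_def of_nat_diff)
  qed
  have avoid: "u \<notin> tset h (l, l)" if "u \<notin> mids h" "l \<noteq> u div 4" for u l
    using that by (auto simp: tset_def mids_def)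
  have upper: "?y u \<le> N - e" for u
  proof (cases "u \<in> mids h")
    case True
    then show ?thesis using le_N[of "\<lambda>t. of_bool (u \<in> tset h t)"] by simp
  next
    case False
    obtain l where "l \<in> I" "l \<noteq> u div 4" using other by blast
    with avoid[OF False] show ?thesis
      using le_N1[of "\<lambda>t. of_bool (u \<in> tset h t)" "(l, l)"] False e by simp
  qed
  have lower: "0 \<le> ?y u" for u
  proof (cases "u \<in> mids h")
    \<comment> \<open>A middle vertex of another index than \<open>l\<close> lies in
      \<open>tset h (l, l)\<close>, and this one set outweighs \<open>e\<close>.\<close>
    case True
    obtain l where l: "l \<in> I" "l \<noteq> u div 4" using other by blast
    then have "u \<in> tset h (l, l)" using True by (auto simp: tset_def mids_def)
    then have "1 \<le> (\<Sum>t\<in>?T. of_bool (u \<in> tset h t) :: real)"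
      using member_le_sum[of "(l, l)" ?T "\<lambda>t. of_bool (u \<in> tset h t) :: real"] fin l by simp
    then show ?thesis using e by simp
  qed (simp add: sum_nonneg)
  have edge: "?y u + ?y v \<le> N - e" if uv: "{u, v} \<in> gedges h" for u v
  proof -
    let ?g = "\<lambda>t. of_bool (u \<in> tset h t) + of_bool (v \<in> tset h t) :: real"
    have g: "?g t \<le> 1" for t using stable_tset[of h t] uv by (auto simp: stable_set_def)
    have M: "\<not> (u \<in> mids h \<and> v \<in> mids h)" using stable_mids[of h] uv by (auto simp: stable_set_def)
    have eq: "?y u + ?y v = sum ?g ?T - e * (of_bool (u \<in> mids h) + of_bool (v \<in> mids h))"
      by (simp add: sum.distrib algebra_simps)
    show ?thesis
    proof (cases "u \<in> mids h \<or> v \<in> mids h")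
      case True
      then show ?thesis unfolding eq using le_N[of ?g] g M by auto
    next
      case False
      obtain l where "l \<in> I" "l \<noteq> u div 4" "l \<noteq> v div 4" using other by blast
      with avoid False have "sum ?g ?T \<le> N - 1"
        by (intro le_N1[of ?g "(l, l)"] g) auto
      with False e show ?thesis unfolding eq by simp
    qed
  qed
  define x where "x v = ?y v / (N - e)" for v
  have pos: "N - e > 0" using N e by simp
  have "x v = 0" if "v \<notin> gverts h" for v
    using that by (simp add: x_def tset_def mids_def)
  moreover have "x u + x v \<le> 1" if "{u, v} \<in> gedges h" for u v
    using edge[OF that] pos by (simp add: x_def add_divide_distrib[symmetric])
  moreover have "0 \<le> x v \<and> x v \<le> 1" for v
    using lower[of v] upper[of v] pos by (simp add: x_def)
  ultimately have "x \<in> FRAC (gverts h) (gedges h)" by (auto simp: FRAC_def vecs_def)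
  moreover have "?y v = (N - e) * x v" for v using pos by (simp add: x_def)
  ultimately show ?thesis
    unfolding homog_cone_iff funpow_0 using pos
    by (intro bexI[of _ x]) (auto simp: N_def)
qed

section \<open>Positive semidefiniteness of the lift\<close>

lemma alternating_sum_square_le:
  fixes p q r s t :: real
  shows "(p - q + r - s + t)\<^sup>2 \<le> 8 * (p\<^sup>2 + q\<^sup>2 + r\<^sup>2 + s\<^sup>2 + t\<^sup>2)"
proof -
  have two: "(x + y)\<^sup>2 \<le> 2 * x\<^sup>2 + 2 * y\<^sup>2" for x y :: real
    using sum_squares_bound[of x y] by (simp add: power2_sum)
  have "(p - q + r - s + t)\<^sup>2 \<le> 2 * (p - q)\<^sup>2 + 2 * (r - s + t)\<^sup>2"
    using two[of "p - q" "r - s + t"] by (simp add: algebra_simps)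
  moreover have "(p - q)\<^sup>2 \<le> 2 * p\<^sup>2 + 2 * q\<^sup>2" "(r - s)\<^sup>2 \<le> 2 * r\<^sup>2 + 2 * s\<^sup>2"
    using two[of p "- q"] two[of r "- s"] by simp_all
  moreover have "(r - s + t)\<^sup>2 \<le> 2 * (r - s)\<^sup>2 + 2 * t\<^sup>2" using two[of "r - s" t] by simp
  moreover have "0 \<le> p\<^sup>2" "0 \<le> q\<^sup>2" "0 \<le> t\<^sup>2" by simp_all
  ultimately show ?thesis unfolding distrib_left by linarith
qed

text \<open>Here \<open>F t\<close>, \<open>m\<close>, \<open>fa\<close>, \<open>fb\<close> are the
  pairings of a test vector with the tight sets, with \<open>mids\<close> and with two unit vectors.
  As \<open>fa\<close> and \<open>fb\<close> both contain \<open>- m\<close>, the product term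
  contributes \<open>2 * m\<^sup>2\<close> and reverses the sign of the negative square. What is
  left after completing the square is \<open>e\<close> times two squares, each at most 8 times the
  sum over tight sets, whence \<open>1 / 16\<close>.\<close>

lemma quadratic_form_nonneg:
  fixes F :: "nat \<times> nat \<Rightarrow> real"
  assumes I: "finite I" "a \<in> I" "b \<in> I" "c \<in> I" "d \<in> I"
    and ne: "c \<noteq> a" "c \<noteq> b" "a \<noteq> d" "b \<noteq> d" "c \<noteq> d"
    and e: "0 \<le> e" "e \<le> 1 / 16"
    and fa: "fa = F (d, d) - F (d, a) + F (c, c) - F (c, a) + F (a, a) - m"
    and fb: "fb = F (d, d) - F (d, b) + F (c, c) - F (c, b) + F (b, b) - m"
  shows "0 \<le> (\<Sum>t\<in>I \<times> I. (F t)\<^sup>2) - e * m\<^sup>2 + 2 * e * (fa * fb)"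
proof -
  let ?Q = "\<Sum>t\<in>I \<times> I. (F t)\<^sup>2"
  have bound: "(F (d, d) - F (d, x) + F (c, c) - F (c, x) + F (x, x))\<^sup>2 \<le> 8 * ?Q"
    if x: "x \<in> I" "c \<noteq> x" "x \<noteq> d" for x
  proof -
    let ?S = "{(d, d), (d, x), (c, c), (c, x), (x, x)}"
    have "(\<Sum>t\<in>?S. (F t)\<^sup>2) \<le> ?Q" using I x by (intro sum_mono2) auto
    moreover have "(\<Sum>t\<in>?S. (F t)\<^sup>2) = (F (d, d))\<^sup>2 + (F (d, x))\<^sup>2 + (F (c, c))\<^sup>2 + (F (c, x))\<^sup>2 + (F (x, x))\<^sup>2"
      using x ne by simp
    ultimately have "8 * ((F (d, d))\<^sup>2 + (F (d, x))\<^sup>2 + (F (c, c))\<^sup>2 + (F (c, x))\<^sup>2 + (F (x, x))\<^sup>2) \<le> 8 * ?Q"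
      by simp
    with alternating_sum_square_le show ?thesis by (rule order_trans)
  qed
  define \<alpha> where "\<alpha> = fa + m"
  define \<beta> where "\<beta> = fb + m"
  have "\<alpha>\<^sup>2 \<le> 8 * ?Q" "\<beta>\<^sup>2 \<le> 8 * ?Q"
    using bound[of a] bound[of b] I ne by (simp_all add: \<alpha>_def \<beta>_def fa fb)
  then have "e * (\<alpha>\<^sup>2 + \<beta>\<^sup>2) \<le> e * (16 * ?Q)" using e by (intro mult_left_mono) auto
  also have "\<dots> \<le> 1 / 16 * (16 * ?Q)" using e by (intro mult_right_mono) (auto simp: sum_nonneg)
  finally have "e * (\<alpha>\<^sup>2 + \<beta>\<^sup>2) \<le> ?Q" by simp
  moreover have "0 \<le> e * (m - \<alpha> - \<beta>)\<^sup>2" using e by simp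
  moreover have "- e * m\<^sup>2 + 2 * e * (fa * fb) = e * (m - \<alpha> - \<beta>)\<^sup>2 - e * (\<alpha>\<^sup>2 + \<beta>\<^sup>2)"
    by (simp add: \<alpha>_def \<beta>_def power2_eq_square algebra_simps)
  ultimately show ?thesis by linarith
qed

lemma quadratic_form_expand:
  fixes u :: "'t \<Rightarrow> 'a \<Rightarrow> real"
  shows "(\<Sum>i\<in>H. \<Sum>j\<in>H. v i * ((\<Sum>t\<in>T. u t i * u t j) - e * (m i * m j)
      + e * (f i * g j + g i * f j)) * v j)
    = (\<Sum>t\<in>T. (\<Sum>i\<in>H. v i * u t i)\<^sup>2) - e * (\<Sum>i\<in>H. v i * m i)\<^sup>2
      + 2 * e * ((\<Sum>i\<in>H. v i * f i) * (\<Sum>i\<in>H. v i * g i))"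
proof -
  have swap: "(\<Sum>i\<in>H. \<Sum>j\<in>H. \<Sum>t\<in>T. v i * (u t i * u t j) * v j)
      = (\<Sum>t\<in>T. \<Sum>i\<in>H. \<Sum>j\<in>H. v i * (u t i * u t j) * v j)"
  proof -
    have "(\<Sum>i\<in>H. \<Sum>j\<in>H. \<Sum>t\<in>T. v i * (u t i * u t j) * v j)
      = (\<Sum>i\<in>H. \<Sum>t\<in>T. \<Sum>j\<in>H. v i * (u t i * u t j) * v j)"
      by (rule sum.cong[OF refl]) (rule sum.swap)
    also have "\<dots> = (\<Sum>t\<in>T. \<Sum>i\<in>H. \<Sum>j\<in>H. v i * (u t i * u t j) * v j)" by (rule sum.swap)
    finally show ?thesis .
  qed
  have "v i * ((\<Sum>t\<in>T. u t i * u t j) - e * (m i * m j) + e * (f i * g j + g i * f j)) * v j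
    = (\<Sum>t\<in>T. v i * (u t i * u t j) * v j) - e * (v i * (m i * m j) * v j)
      + e * (v i * (f i * g j) * v j) + e * (v i * (g i * f j) * v j)" for i j
    by (simp add: algebra_simps sum_distrib_left)
  then show ?thesis
    by (simp add: sum.distrib sum_subtractf swap quadratic_form_rank_one power2_eq_square
        flip: sum_distrib_left)
qed

text \<open>The multiple \<open>4 * e\<close> in the hypothesis pays for the columns: those of the
  middles of \<open>a\<close> and \<open>b\<close> use half of a base point to cover
  \<open>2 * e\<close>, and the others use a whole one to cover \<open>e\<close>. The bound
  \<open>1 / 16\<close> serves positive semidefiniteness.\<close>

lemma tset_sum_in_lscone_Suc:
  assumes I: "finite I" "I \<subseteq> {..<2 * h + 1}" "card I \<ge> 4" and e: "0 < e" "e \<le> 1 / 16"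
    and IH: "\<And>i. i \<in> I \<Longrightarrow>
      (\<lambda>j. (\<Sum>t\<in>(I - {i}) \<times> (I - {i}). chi (tset h t) j) - 4 * e * chi (mids h) j) \<in> lscone h k"
  shows "(\<lambda>j. (\<Sum>t\<in>I \<times> I. chi (tset h t) j) - e * chi (mids h) j) \<in> lscone h (Suc k)"
proof -
  obtain a b c d where abcd: "a \<in> I" "b \<in> I" "c \<in> I" "d \<in> I" "a \<noteq> b"
    and arcs: "arc h c a" "arc h c b" "arc h a d" "arc h b d"
    by (rule arc_diamond[OF I(2,3)])
  have ne: "c \<noteq> a" "c \<noteq> b" "a \<noteq> d" "b \<noteq> d" "c \<noteq> d"
    using arcs arc_neq arc_asym by metis+
  have lt: "a < 2 * h + 1" "b < 2 * h + 1" using I abcd by auto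
  let ?T = "I \<times> I"
  let ?u = "\<lambda>t. chi (tset h t)"
  let ?m = "chi (mids h)"
  define ea where "ea j = (of_bool (j = Some (4 * a + 1)) :: real)" for j
  define eb where "eb j = (of_bool (j = Some (4 * b + 1)) :: real)" for j
  \<comment> \<open>The last term sits off the diagonal, because \<open>a\<close> and
    \<open>b\<close> differ, and off column \<open>None\<close>. It changes neither the represented
    point nor any column except those of the middles of \<open>a\<close> and
    \<open>b\<close>.\<close>
  define Y where "Y i j = (\<Sum>t\<in>?T. ?u t i * ?u t j) - e * (?m i * ?m j)
      + e * (ea i * eb j + eb i * ea j)" for i j
  have e0: "ea None = 0" "eb None = 0" by (simp_all add: ea_def eb_def)
  have col0: "Y j None = (\<Sum>t\<in>?T. ?u t j) - e * ?m j" for j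
    by (simp add: Y_def e0)
  have col: "Y j (Some x) = (\<Sum>t\<in>?T. ?u t (Some x) * ?u t j) - e * of_bool (x \<in> mids h) * ?m j
      + e * (ea j * eb (Some x) + eb j * ea (Some x))" for j x
    by (simp add: Y_def mult_ac)
  have col0': "Y j None - Y j (Some x) = (\<Sum>t\<in>?T. (1 - ?u t (Some x)) * ?u t j)
      - e * (1 - of_bool (x \<in> mids h)) * ?m j - e * (ea j * eb (Some x) + eb j * ea (Some x))" for j x
    unfolding col col0 by (simp add: left_diff_distrib right_diff_distrib sum_subtractf)
  let ?P = "(LS_plus (gverts h) ^^ k) (FRAC (gverts h) (gedges h))"
  have away: "\<exists>i0\<in>I. \<forall>t\<in>(I - {i0}) \<times> (I - {i0}). i \<noteq> fst t \<and> i \<noteq> snd t" for i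
  proof (cases "i \<in> I")
    case True
    then show ?thesis by (intro bexI[of _ i]) auto
  next
    case False
    then show ?thesis using abcd by (intro bexI[of _ a]) auto
  qed
  have columns: "(\<lambda>j. Y j (Some x)) \<in> lscone h k \<and> (\<lambda>j. Y j None - Y j (Some x)) \<in> lscone h k"
    if x: "x \<in> gverts h" for x
  proof (cases "x mod 4 = 1")
    case False
    then have xm: "x \<notin> mids h" by (simp add: mids_def)
    have x0: "ea (Some x) = 0" "eb (Some x) = 0" using False by (auto simp: ea_def eb_def)
    \<comment> \<open>Tight sets from pairs avoiding the index of \<open>x\<close> do not contain
      the non-middle vertex \<open>x\<close>. They keep coefficient 1 in the complementary column,
      so the base point for \<open>I - {i}\<close> fits there.\<close>
    obtain i where i: "i \<in> I" "\<And>t. t \<in> (I - {i}) \<times> (I - {i}) \<Longrightarrow> x div 4 \<noteq> fst t \<and> x div 4 \<noteq> snd t"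
      using away[of "x div 4"] by blast
    have "(\<lambda>j. (\<Sum>t\<in>?T. (1 - ?u t (Some x)) * ?u t j) - e * ?m j) \<in> lscone h k"
    proof (rule lscone_combination[OF _ _ IH[OF i(1)], where r = 1])
      show "1 \<le> 1 - ?u t (Some x)" if "t \<in> (I - {i}) \<times> (I - {i})" for t
        using i(2)[OF that] False by (auto simp: tset_def)
    qed (use I e in auto)
    moreover have "(\<lambda>j. \<Sum>t\<in>?T. ?u t (Some x) * ?u t j) \<in> lscone h k"
      by (rule lscone_sum) simp
    ultimately show ?thesis unfolding col0' unfolding col using xm x0 by simp
  next
    case True
    define i where "i = x div 4"
    have xi: "x = 4 * i + 1" using div_mult_mod_eq[of x 4] True unfolding i_def by linarith
    have i: "i < 2 * h + 1" using x unfolding gverts_def i_def by blast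
    have xm: "x \<in> mids h" using x True by (simp add: mids_def)
    consider "i = a" | "i = b" | "i \<noteq> a" "i \<noteq> b" by blast
    then show ?thesis
    proof cases
      case 1
      then have "ea (Some x) = 1" "eb (Some x) = 0" using abcd xi by (auto simp: ea_def eb_def)
      then show ?thesis unfolding col0' unfolding col
        using mid_columns_in_lscone[OF I(1,2) abcd arcs IH[OF abcd(1)]] e xm xi 1
        by (simp add: eb_def)
    next
      case 2
      then have "ea (Some x) = 0" "eb (Some x) = 1" using abcd xi by (auto simp: ea_def eb_def)
      then show ?thesis unfolding col0' unfolding col
        using mid_columns_in_lscone[OF I(1,2) abcd(2,1,3,4) abcd(5)[symmetric] arcs(2,1,4,3) IH[OF abcd(2)]]
          e xm xi 2
        by (simp add: ea_def)
    next
      \<comment> \<open>For a middle vertex the roles are exchanged: tight sets from pairs avoiding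
        its index contain it, so the base point goes into the column, and the complementary column
        has no \<open>mids\<close> term.\<close>
      case 3
      then have x0: "ea (Some x) = 0" "eb (Some x) = 0" using xi by (auto simp: ea_def eb_def)
      obtain i0 where i0: "i0 \<in> I" "\<And>t. t \<in> (I - {i0}) \<times> (I - {i0}) \<Longrightarrow> i \<noteq> fst t \<and> i \<noteq> snd t"
        using away[of i] by blast
      have "(\<lambda>j. (\<Sum>t\<in>?T. ?u t (Some x) * ?u t j) - e * ?m j) \<in> lscone h k"
      proof (rule lscone_combination[OF _ _ IH[OF i0(1)], where r = 1])
        show "1 \<le> ?u t (Some x)" if "t \<in> (I - {i0}) \<times> (I - {i0})" for t
          using i0(2)[OF that] tset_mid_iff[OF i] unfolding xi by simp
      qed (use I e in auto)
      moreover have "(\<lambda>j. \<Sum>t\<in>?T. (1 - ?u t (Some x)) * ?u t j) \<in> lscone h k"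
        by (rule lscone_sum) simp
      ultimately show ?thesis unfolding col0' unfolding col using xm x0 by simp
    qed
  qed
  have out: "?u t j = 0" "?m j = 0" "ea j = 0" "eb j = 0" if "j \<notin> homog_index (gverts h)" for t j
    using that lt by (cases j; auto simp: homog_index_def tset_def mids_def ea_def eb_def gverts_def)+
  have Y: "Y \<in> LS_plus_lift (gverts h) ?P"
    unfolding LS_plus_lift_def sym_psd_def mats_def mem_Collect_eq
  proof (intro conjI allI ballI impI)
    show "Y i j = 0" if "i \<notin> homog_index (gverts h) \<or> j \<notin> homog_index (gverts h)" for i j
      unfolding Y_def using that by (elim disjE) (simp_all add: out)
    show "Y i j = Y j i" for i j by (simp add: Y_def mult_ac)
    have ab: "ea j * eb j = 0" "eb j * ea j = 0" for j
      using abcd(5) by (simp_all add: ea_def eb_def)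
    have idem: "chi S j * chi S j = chi S j" for S and j :: "nat option" by (cases j) auto
    have "Y j None = Y j j" for j
      unfolding col0 unfolding Y_def ab idem by simp
    then show "(\<lambda>j. Y j None) = (\<lambda>j. Y j j)" by blast
    show "0 \<le> (\<Sum>i\<in>homog_index (gverts h). \<Sum>j\<in>homog_index (gverts h). v i * Y i j * v j)" for v
      unfolding Y_def quadratic_form_expand
    proof (rule quadratic_form_nonneg[OF I(1) abcd(1-4) ne _ e(2)])
      have F: "(\<Sum>i\<in>H. v i * (p i - q i + r i - s i + t i - m i)) = (\<Sum>i\<in>H. v i * p i)
        - (\<Sum>i\<in>H. v i * q i) + (\<Sum>i\<in>H. v i * r i) - (\<Sum>i\<in>H. v i * s i)
        + (\<Sum>i\<in>H. v i * t i) - (\<Sum>i\<in>H. v i * m i)" for p q r s t m :: "nat option \<Rightarrow> real" and H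
        by (simp add: algebra_simps sum.distrib sum_subtractf)
      show "(\<Sum>i\<in>homog_index (gverts h). v i * ea i) = (\<Sum>i\<in>homog_index (gverts h). v i * ?u (d, d) i)
        - (\<Sum>i\<in>homog_index (gverts h). v i * ?u (d, a) i) + (\<Sum>i\<in>homog_index (gverts h). v i * ?u (c, c) i)
        - (\<Sum>i\<in>homog_index (gverts h). v i * ?u (c, a) i) + (\<Sum>i\<in>homog_index (gverts h). v i * ?u (a, a) i)
        - (\<Sum>i\<in>homog_index (gverts h). v i * ?m i)"
        unfolding ea_def mid_as_combination[OF lt(1) arcs(1,3)] by (rule F)
      show "(\<Sum>i\<in>homog_index (gverts h). v i * eb i) = (\<Sum>i\<in>homog_index (gverts h). v i * ?u (d, d) i)
        - (\<Sum>i\<in>homog_index (gverts h). v i * ?u (d, b) i) + (\<Sum>i\<in>homog_index (gverts h). v i * ?u (c, c) i)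
        - (\<Sum>i\<in>homog_index (gverts h). v i * ?u (c, b) i) + (\<Sum>i\<in>homog_index (gverts h). v i * ?u (b, b) i)
        - (\<Sum>i\<in>homog_index (gverts h). v i * ?m i)"
        unfolding eb_def mid_as_combination[OF lt(2) arcs(2,4)] by (rule F)
    qed (use e in simp)
  qed (use columns in auto)
  have "card I * card I \<ge> 4 * 4" using I(3) by (intro mult_le_mono)
  then have "real (card I * card I) \<ge> 16" by linarith
  then have "Y None None > 0" unfolding col0 using e by (simp add: card_cartesian_product)
  from LS_plus_lift_column_in_cone[OF Y this] show ?thesis unfolding col0 by simp
qed

text \<open>Each level gives up one index and quarters the perturbation, matching the factor 4 of
  the induction step; three indices remain at level 0.\<close>

lemma tset_sum_in_lscone:
  assumes "I \<subseteq> {..<2 * h + 1}" "card I = k + 3"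
  shows "(\<lambda>j. (\<Sum>t\<in>I \<times> I. chi (tset h t) j) - (1 / 4) ^ Suc k * chi (mids h) j) \<in> lscone h k"
  using assms
proof (induction k arbitrary: I)
  case 0
  then have "finite I" by (auto intro: finite_subset)
  with 0 show ?case by (intro tset_sum_in_lscone_0) auto
next
  case (Suc k)
  have fin: "finite I" using Suc.prems(1) by (auto intro: finite_subset)
  have "(1 / 4 :: real) ^ k \<le> 1" by (simp add: power_le_one)
  then have e: "(1 / 4 :: real) ^ Suc (Suc k) \<le> 1 / 16" by simp
  show ?case
  proof (rule tset_sum_in_lscone_Suc[OF fin Suc.prems(1) _ _ e])
    show "(\<lambda>j. (\<Sum>t\<in>(I - {i}) \<times> (I - {i}). chi (tset h t) j)
        - 4 * (1 / 4) ^ Suc (Suc k) * chi (mids h) j) \<in> lscone h k" if "i \<in> I" for i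
      using Suc.IH[of "I - {i}"] Suc.prems that fin by auto
  qed (use Suc.prems in auto)
qed

section \<open>The violated inequality\<close>

definition layers :: "nat \<Rightarrow> (nat \<Rightarrow> real) \<Rightarrow> real" where
  "layers h x = (\<Sum>i<2 * h + 1. x (4 * i) + x (4 * i + 1) + x (4 * i + 2))"

text \<open>The excess \<open>?f i\<close> of an index over 1 is positive only if both ends are
  chosen, and then it is 1. Two such indices are joined by an arc, hence by an edge from layer 2 to
  layer 0, so at most one index has positive excess.\<close>

lemma layers_integral_le:
  assumes x: "x \<in> FRAC (gverts h) (gedges h)" and int: "\<And>v. v \<in> gverts h \<Longrightarrow> x v \<in> {0, 1}"
  shows "layers h x \<le> real (2 * h + 2)"
proof -
  let ?f = "\<lambda>i. x (4 * i) + x (4 * i + 1) + x (4 * i + 2) - 1"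
  have V: "4 * i + p \<in> gverts h" if "i < 2 * h + 1" "p < 4" for i p
    using that by (simp add: gverts_def)
  have edge: "x u + x v \<le> 1" if "u \<in> gverts h" "v \<in> gverts h" "gadj h u v" for u v
    using x that by (auto simp: FRAC_def gedges_iff)
  have on: "x (4 * i) = 1 \<and> x (4 * i + 2) = 1 \<and> ?f i = 1" if i: "i < 2 * h + 1" "?f i > 0" for i
  proof -
    have adj: "gadj h (4 * i + 0) (4 * i + 1)" "gadj h (4 * i + 1) (4 * i + 2)"
      by (subst gadj_code; simp)+
    have "x (4 * i + 0) + x (4 * i + 1) \<le> 1" "x (4 * i + 1) + x (4 * i + 2) \<le> 1"
      using edge[OF V[OF i(1)] V[OF i(1)] adj(1)] edge[OF V[OF i(1)] V[OF i(1)] adj(2)]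
      by simp_all
    moreover have "x (4 * i + 0) \<in> {0, 1}" "x (4 * i + 1) \<in> {0, 1}" "x (4 * i + 2) \<in> {0, 1}"
      by (rule int[OF V[OF i(1)]]; simp)+
    ultimately show ?thesis using i(2) by auto
  qed
  have unique: "i = j" if ij: "i < 2 * h + 1" "?f i > 0" "j < 2 * h + 1" "?f j > 0" for i j
  proof (rule ccontr)
    assume "i \<noteq> j"
    have "False" if "arc h i j" "i < 2 * h + 1" "?f i > 0" "j < 2 * h + 1" "?f j > 0" for i j
    proof -
      have "gadj h (4 * i + 2) (4 * j + 0)" using that(1) by (subst gadj_code) auto
      from edge[OF V[OF that(2)] V[OF that(4)] this] have "x (4 * i + 2) + x (4 * j + 0) \<le> 1" by simp
      then show False using on[of i] on[of j] that by simp
    qed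
    then show False using ij arc_total[OF \<open>i \<noteq> j\<close>] by blast
  qed
  have "(\<Sum>i<2 * h + 1. ?f i) \<le> 1"
  proof (cases "\<exists>i<2 * h + 1. ?f i > 0")
    case True
    then obtain i where i: "i < 2 * h + 1" "?f i > 0" by blast
    have "(\<Sum>i<2 * h + 1. ?f i) = ?f i + sum ?f ({..<2 * h + 1} - {i})"
      using i by (intro sum.remove) auto
    moreover have "sum ?f ({..<2 * h + 1} - {i}) \<le> 0"
    proof (rule sum_nonpos)
      fix j assume "j \<in> {..<2 * h + 1} - {i}"
      then have "j < 2 * h + 1" "i \<noteq> j" by auto
      with unique[OF i] have "\<not> 0 < ?f j" by blast
      then show "?f j \<le> 0" by (rule leI)
    qed
    ultimately show ?thesis using on[OF i] by linarith
  next
    case False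
    have "(\<Sum>i<2 * h + 1. ?f i) \<le> 0"
    proof (rule sum_nonpos)
      fix j assume "j \<in> {..<2 * h + 1}"
      then have "\<not> 0 < ?f j" using False by blast
      then show "?f j \<le> 0" by (rule leI)
    qed
    then show ?thesis by linarith
  qed
  then show ?thesis by (simp add: layers_def sum_subtractf del: sum.lessThan_Suc)
qed

lemma layers_STAB_le:
  assumes "x \<in> STAB (gverts h) (gedges h)"
  shows "layers h x \<le> real (2 * h + 2)"
proof -
  obtain S u where S: "finite S"
    "S \<subseteq> FRAC (gverts h) (gedges h) \<inter> {x \<in> vecs (gverts h). \<forall>i\<in>gverts h. x i \<in> {0, 1}}"
    "\<forall>s\<in>S. 0 \<le> u s" "sum u S = 1" and x: "x = (\<lambda>i. \<Sum>s\<in>S. u s * s i)"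
    using assms by (auto simp: STAB_def integer_hull_def conv_hull_def)
  have "layers h x = (\<Sum>i<2 * h + 1. \<Sum>s\<in>S. u s * (s (4 * i) + s (4 * i + 1) + s (4 * i + 2)))"
    by (simp add: layers_def x distrib_left sum.distrib)
  also have "\<dots> = (\<Sum>s\<in>S. u s * layers h s)"
    unfolding layers_def sum_distrib_left by (rule sum.swap)
  also have "\<dots> \<le> (\<Sum>s\<in>S. u s * real (2 * h + 2))"
  proof (intro sum_mono mult_left_mono)
    fix s assume s: "s \<in> S"
    then show "layers h s \<le> real (2 * h + 2)"
      using S(2) by (intro layers_integral_le) auto
    show "0 \<le> u s" using S(3) s by blast
  qed
  also have "\<dots> = real (2 * h + 2)" using S(4) by (simp flip: sum_distrib_right)
  finally show ?thesis .
qed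

text \<open>Each index contributes one vertex, and \<open>fst t\<close> contributes a second
  one.\<close>

lemma layers_tset:
  assumes "fst t < 2 * h + 1"
  shows "layers h (\<lambda>v. of_bool (v \<in> tset h t)) = real (2 * h + 2)"
proof -
  have "layers h (\<lambda>v. of_bool (v \<in> tset h t)) = (\<Sum>i<2 * h + 1. 1 + of_bool (i = fst t))"
    unfolding layers_def
  proof (rule sum.cong[OF refl])
    fix i assume "i \<in> {..<2 * h + 1}"
    then have i: "i < 2 * h + 1" by simp
    have "4 * i \<in> tset h t \<longleftrightarrow> i = fst t \<or> i = snd t \<and> i \<noteq> fst t \<and> arc h (snd t) (fst t)"
      "4 * i + 2 \<in> tset h t \<longleftrightarrow> i = fst t \<or> i = snd t \<and> i \<noteq> fst t \<and> \<not> arc h (snd t) (fst t)"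
      using i by (auto simp: tset_def gverts_def)
    with tset_mid_iff[OF i, of t]
    show "of_bool (4 * i \<in> tset h t) + of_bool (4 * i + 1 \<in> tset h t)
      + of_bool (4 * i + 2 \<in> tset h t) = (1 + of_bool (i = fst t) :: real)"
      by (simp only:) auto
  qed
  also have "\<dots> = real (2 * h + 2)"
    using assms by (simp add: sum.distrib of_bool_def del: sum.lessThan_Suc)
  finally show ?thesis .
qed

lemma layers_mids: "layers h (\<lambda>v. of_bool (v \<in> mids h)) = real (2 * h + 1)"
proof -
  have "layers h (\<lambda>v. of_bool (v \<in> mids h)) = (\<Sum>i<2 * h + 1. 1)"
    unfolding layers_def by (rule sum.cong[OF refl]) (auto simp: mids_def gverts_def)
  then show ?thesis by simp
qed

text \<open>All \<open>2 * h + 1\<close> indices are used, so the level is \<open>2 * h - 2\<close>.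
  Since \<open>mids h\<close> falls short of the bound by 1, subtracting \<open>e\<close> copies of
  it leaves a point exceeding the homogenised inequality by exactly \<open>e\<close>.\<close>

lemma LS_plus_iter_not_subset_STAB:
  assumes "h \<ge> 1"
  shows "\<not> (LS_plus (gverts h) ^^ (2 * h - 2)) (FRAC (gverts h) (gedges h))
    \<subseteq> STAB (gverts h) (gedges h)"
proof
  let ?P = "(LS_plus (gverts h) ^^ (2 * h - 2)) (FRAC (gverts h) (gedges h))"
  let ?I = "{..<2 * h + 1}"
  define e where "e = (1 / 4 :: real) ^ Suc (2 * h - 2)"
  define N where "N = real (card (?I \<times> ?I))"
  assume sub: "?P \<subseteq> STAB (gverts h) (gedges h)"
  have "(\<lambda>j. (\<Sum>t\<in>?I \<times> ?I. chi (tset h t) j) - e * chi (mids h) j) \<in> homog_cone ?P"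
    unfolding e_def by (rule tset_sum_in_lscone) (use assms in auto)
  then obtain x where x: "x \<in> ?P" and t: "0 \<le> N - e"
    and y: "\<And>v. (\<Sum>t\<in>?I \<times> ?I. of_bool (v \<in> tset h t)) - e * of_bool (v \<in> mids h) = (N - e) * x v"
    unfolding homog_cone_iff by (auto simp: N_def)
  have "layers h x \<le> real (2 * h + 2)" using sub x layers_STAB_le by blast
  then have "(N - e) * layers h x \<le> (N - e) * real (2 * h + 2)" using t by (rule mult_left_mono)
  moreover have "(N - e) * layers h x = N * real (2 * h + 2) - e * real (2 * h + 1)"
  proof -
    have "(N - e) * layers h x = layers h (\<lambda>v. (\<Sum>t\<in>?I \<times> ?I. of_bool (v \<in> tset h t)) - e * of_bool (v \<in> mids h))"
      unfolding y by (simp only: layers_def sum_distrib_left distrib_left)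
    also have "\<dots> = (\<Sum>t\<in>?I \<times> ?I. layers h (\<lambda>v. of_bool (v \<in> tset h t)))
        - e * layers h (\<lambda>v. of_bool (v \<in> mids h))"
      unfolding layers_def sum.swap[of _ _ "?I \<times> ?I"]
      by (simp only: sum.distrib sum_subtractf sum_distrib_left distrib_left algebra_simps)
    also have "\<dots> = N * real (2 * h + 2) - e * real (2 * h + 1)"
      unfolding layers_mids N_def by (subst sum.cong[OF refl layers_tset]) auto
    finally show ?thesis .
  qed
  moreover have "e > 0" by (simp add: e_def)
  ultimately show False by (simp add: algebra_simps)
qed

theorem theorem4p8:
  fixes l :: nat
  assumes "l \<ge> 1"
  shows "\<exists>(V :: nat set) E. simple_graph V E \<and> vertex_transitive V E \<and>
           card V \<le> 4 * l + 12 \<and> r_plus V E \<ge> enat l"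
proof -
  \<comment> \<open>This makes \<open>2 * h + 1\<close> the least odd number that is at least
    \<open>l + 2\<close>: the graph has at most \<open>4 * (l + 3)\<close> vertices, and level
    \<open>2 * h - 2\<close> is at least \<open>l - 1\<close>.\<close>
  define h where "h = (l + 2) div 2"
  have h: "h \<ge> 1" "l + 2 \<le> 2 * h + 1" "2 * h + 1 \<le> l + 3" using assms unfolding h_def by linarith+
  have "card (gverts h) \<le> 4 * l + 12" using h by (simp add: gverts_eq)
  moreover have "enat l \<le> r_plus (gverts h) (gedges h)"
    unfolding r_plus_def
  proof (rule Inf_greatest, clarsimp)
    fix k assume k: "(LS_plus (gverts h) ^^ k) (FRAC (gverts h) (gedges h)) = STAB (gverts h) (gedges h)"
    show "l \<le> k"
    proof (rule ccontr)
      assume "\<not> l \<le> k"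
      then have "k \<le> 2 * h - 2" using h by linarith
      moreover have "0 \<in> gverts h" by (simp add: gverts_def)
      ultimately show False
        using LS_plus_iter_antimono LS_plus_iter_not_subset_STAB[OF h(1)] k by (metis empty_iff)
    qed
  qed
  ultimately show ?thesis using simple_graph_g vertex_transitive_g by blast
qed

end
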